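(* Let $\gamma\in[0,1]$ and let $C_\gamma$ be the $\gamma$-relative surprise region for $\tau=\Upsilon(\theta)$. The prior probability of $C_\gamma$ containing an independent value generated from the prior is always less than the prior probability of $C_\gamma$ containing the true value, when the true value is generated from the prior; that is, $$\int_\Theta\int_{\mathcal{T}}P_\theta(\tau\in C_\gamma(X))\,\Pi_\Upsilon(d\tau)\,\Pi(d\theta)<\int_\Theta P_\theta(\Upsilon(\theta)\in C_\gamma(X))\,\Pi(d\theta).$$
   Context: Setting: $\{f_\theta:\theta\in\Theta\}$ is a statistical model, $f_\theta$ being the density of a probability measure $P_\theta$ with respect to a support measure $\mu$ on the sample space $\mathcal{X}$. $\Pi$ is a proper prior (a probability measure) on $\Theta$, with density $\pi$ with respect to a support measure $\upsilon$ on $\Theta$. The joint distribution of $(\theta,X)$ is $\theta\sim\Pi$, $X\mid\theta\sim P_\theta$. The parameter of interest is $\tau=\Upsilon(\theta)\in\mathcal{T}$; $\Pi_\Upsilon$ and $\Pi_\Upsilon(\cdot\mid x)$ are its marginal prior and posterior (given $X=x$) distributions, with densities $\pi_\Upsilon$ and $\pi_\Upsilon(\cdot\mid x)$ with respect to a support measure $\nu_{\mathcal{T}}$ on $\mathcal{T}$. It is assumed that $\pi_\Upsilon(\tau)>0$ for every $\tau\in\mathcal{T}$. For $x\in\mathcal{X}$ the $\gamma$-relative surprise region is $$C_\gamma(x)=\left\{\tau_0\in\mathcal{T}:\Pi_\Upsilon\left(\left\{\tau:\frac{\pi_\Upsilon(\tau\mid x)}{\pi_\Upsilon(\tau)}>\frac{\pi_\Upsilon(\tau_0\mid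 x)}{\pi_\Upsilon(\tau_0)}\right\}\,\Big|\,x\right)\le\gamma\right\}.$$ The independent value is $\tau\sim\Pi_\Upsilon$, generated independently of $(\theta,X)$; the true value is $\Upsilon(\theta)$ with $\theta\sim\Pi$ and $X\mid\theta\sim P_\theta$.
   Formalization: Strict inequality fails in general (e.g. γ=1, where both sides equal 1); what is proved is ≤ always, with < exactly when, with positive prior predictive probability, the prior content of C_γ(X) lies strictly between 0 and 1; μ is taken σ-finite and the densities jointly measurable. *)

theory Defs
  imports "HOL-Probability.Probability"
begin

text \<open>
  The support measures \<open>\<mu>\<close>, \<open>\<upsilon>\<close>, \<open>\<nu>\<close> carry the sample space, the parameter space and the space
  of the parameter of interest as their \<^const>\<open>space\<close>. Densities are real-valued.
\<close>

definition model :: "'x measure \<Rightarrow> ('p \<Rightarrow> 'x \<Rightarrow> real) \<Rightarrow> 'p \<Rightarrow> 'x measure" where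
  "model \<mu> f \<theta> = density \<mu> (\<lambda>x. ennreal (f \<theta> x))"

definition prior :: "'p measure \<Rightarrow> ('p \<Rightarrow> real) \<Rightarrow> 'p measure" where
  "prior \<upsilon> p = density \<upsilon> (\<lambda>\<theta>. ennreal (p \<theta>))"

definition predictive_density ::
  "'p measure \<Rightarrow> ('p \<Rightarrow> real) \<Rightarrow> ('p \<Rightarrow> 'x \<Rightarrow> real) \<Rightarrow> 'x \<Rightarrow> ennreal" where
  "predictive_density \<upsilon> p f x = (\<integral>\<^sup>+\<theta>. ennreal (p \<theta> * f \<theta> x) \<partial>\<upsilon>)"

definition prior_predictive ::
  "'x measure \<Rightarrow> 'p measure \<Rightarrow> ('p \<Rightarrow> real) \<Rightarrow> ('p \<Rightarrow> 'x \<Rightarrow> real) \<Rightarrow> 'x measure" where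
  "prior_predictive \<mu> \<upsilon> p f = density \<mu> (predictive_density \<upsilon> p f)"

text \<open>
  Bayes' formula. Where the predictive density is \<open>0\<close> or \<open>\<infinity>\<close> (a null set of the prior predictive)
  the posterior below is the zero measure.
\<close>

definition posterior ::
  "'p measure \<Rightarrow> ('p \<Rightarrow> real) \<Rightarrow> ('p \<Rightarrow> 'x \<Rightarrow> real) \<Rightarrow> 'x \<Rightarrow> 'p measure" where
  "posterior \<upsilon> p f x =
     density \<upsilon> (\<lambda>\<theta>. ennreal (p \<theta> * f \<theta> x) / predictive_density \<upsilon> p f x)"

definition marginal_prior ::
  "'p measure \<Rightarrow> ('p \<Rightarrow> real) \<Rightarrow> 't measure \<Rightarrow> ('p \<Rightarrow> 't) \<Rightarrow> 't measure" where
  "marginal_prior \<upsilon> p \<nu> \<Upsilon> = distr (prior \<upsilon> p) \<nu> \<Upsilon>"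

definition marginal_posterior ::
  "'p measure \<Rightarrow> ('p \<Rightarrow> real) \<Rightarrow> ('p \<Rightarrow> 'x \<Rightarrow> real) \<Rightarrow> 't measure \<Rightarrow> ('p \<Rightarrow> 't) \<Rightarrow> 'x \<Rightarrow> 't measure"
where
  "marginal_posterior \<upsilon> p f \<nu> \<Upsilon> x = distr (posterior \<upsilon> p f x) \<nu> \<Upsilon>"

text \<open>
  Given the marginal posteriors \<open>Q\<close>, a marginal prior density \<open>q\<close> and marginal posterior densities
  \<open>qx\<close>, all with respect to \<open>\<nu>\<close>.
\<close>

definition relative_surprise_region ::
  "'t measure \<Rightarrow> ('x \<Rightarrow> 't measure) \<Rightarrow> ('t \<Rightarrow> real) \<Rightarrow> ('x \<Rightarrow> 't \<Rightarrow> real) \<Rightarrow> real \<Rightarrow> 'x \<Rightarrow> 't set" where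
  "relative_surprise_region \<nu> Q q qx \<gamma> x =
     {\<tau>0 \<in> space \<nu>.
        measure (Q x) {\<tau> \<in> space \<nu>. qx x \<tau> / q \<tau> > qx x \<tau>0 / q \<tau>0} \<le> \<gamma>}"

end

theory Submission imports Defs
begin

text \<open>
  By Tonelli and Bayes' formula, the two sides are the means under the prior predictive of the
  marginal prior and the marginal posterior probability of \<open>C(x)\<close>. For almost every \<open>x\<close> the marginal
  posterior has the density \<open>r = qx / q\<close> with respect to the marginal prior, and \<open>C(x)\<close> is an upper
  level set of \<open>r\<close>: every value of \<open>r\<close> on \<open>C(x)\<close> strictly exceeds every value off it. Separating
  these values by a constant \<open>c\<close> shows that the posterior probability of \<open>C(x)\<close> is at least its prior
  probability, and that for a prior probability in \<open>(0, 1)\<close> equality would force \<open>r = c\<close> almost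
  everywhere both on and off \<open>C(x)\<close>.
\<close>

section \<open>Upper level sets of a density\<close>

text \<open>In the nondegenerate case a constant separating the values of \<open>r\<close> on and
  off \<open>S\<close> gives a strict gain. In the degenerate cases equality holds: \<open>Q\<close>
  is absolutely continuous with respect to \<open>R\<close>, so it inherits null sets, and the
  probabilities 0 and 1 of \<open>S\<close> carry over from \<open>R\<close> to
  \<open>Q\<close>.\<close>

lemma upper_level_set_prob:
  fixes r :: "'a \<Rightarrow> real"
  assumes "prob_space R" and "prob_space Q"
    and Q: "Q = density R (\<lambda>a. ennreal (r a))"
    and r [measurable]: "r \<in> borel_measurable R"
    and S [measurable]: "S \<in> sets R"
    and nonneg: "\<And>a. a \<in> space R \<Longrightarrow> 0 \<le> r a"
    and above: "\<And>a b. a \<in> S \<Longrightarrow> b \<in> space R - S \<Longrightarrow> r b < r a"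
  shows "measure R S \<le> measure Q S"
    and "measure R S < measure Q S \<longleftrightarrow> 0 < measure R S \<and> measure R S < 1"
proof -
  interpret R: prob_space R by fact
  interpret Q: prob_space Q by fact
  have sets_Q [simp]: "sets Q = sets R" and space_Q [simp]: "space Q = space R"
    by (simp_all add: Q)
  have "(\<integral>\<^sup>+a. ennreal (r a) \<partial>R) = 1"
    using Q.emeasure_space_1 by (simp add: Q emeasure_density cong: nn_integral_cong)
  then have int_r: "integrable R r"
    using nonneg by (intro integrableI_nonneg) auto
  have int_ind: "integrable R (\<lambda>a. indicator A a * r a)" if "A \<in> sets R" for A
    using integrable_real_mult_indicator[OF that int_r] by (simp add: mult.commute)
  have Q_eq: "measure Q A = (\<integral>a. indicator A a * r a \<partial>R)" if [measurable]: "A \<in> sets R" for A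
  proof -
    have "emeasure Q A = (\<integral>\<^sup>+a. ennreal (indicator A a * r a) \<partial>R)"
      unfolding Q by (subst emeasure_density) (auto simp: indicator_def intro!: nn_integral_cong)
    also have "\<dots> = ennreal (\<integral>a. indicator A a * r a \<partial>R)"
      using nonneg by (intro nn_integral_eq_integral int_ind that) (auto simp: indicator_def)
    finally have "emeasure Q A = ennreal (\<integral>a. indicator A a * r a \<partial>R)" .
    moreover have "0 \<le> (\<integral>a. indicator A a * r a \<partial>R)"
      using nonneg by (intro Bochner_Integration.integral_nonneg) (auto simp: indicator_def)
    ultimately show ?thesis
      by (simp add: measure_def)
  qed
  have int_const: "integrable R (\<lambda>a. indicator A a * c)" if "A \<in> sets R" for A and c :: real
    using that by (intro integrable_mult_left integrable_real_indicator) (auto simp: less_top[symmetric])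
  have strict: "measure R S < measure Q S" if pos: "0 < measure R S" "measure R S < 1"
  proof (rule ccontr)
    assume "\<not> measure R S < measure Q S"
    then have le: "measure Q S \<le> measure R S" by simp
    let ?T = "space R - S"
    have [measurable]: "?T \<in> sets R" by simp
    have RT: "measure R ?T = 1 - measure R S" by (rule R.prob_compl[OF S])
    have QT: "measure Q ?T = 1 - measure Q S" using Q.prob_compl[of S] by simp
    have "S \<noteq> {}" using pos by auto
    have "?T \<noteq> {}"
    proof
      assume "?T = {}"
      then have "measure R ?T = 0" by (simp only: measure_empty)
      with pos RT show False by simp
    qed
    \<comment> \<open>The separating constant. A point of \<open>S\<close> bounds the values on
      \<open>?T\<close>, so they lie below the supremum; since \<open>?T\<close> is nonempty, the
      supremum in turn lies below every value on \<open>S\<close>.\<close>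
    define c where "c = Sup (r ` ?T)"
    obtain s where "s \<in> S" using \<open>S \<noteq> {}\<close> by auto
    have bdd: "bdd_above (r ` ?T)"
      using above[OF \<open>s \<in> S\<close>] by (intro bdd_aboveI2[of _ _ "r s"]) (auto intro: less_imp_le)
    have le_c: "r b \<le> c" if "b \<in> ?T" for b
      unfolding c_def using bdd that by (intro cSup_upper) auto
    have ge_c: "c \<le> r a" if "a \<in> S" for a
      unfolding c_def using above[OF that] \<open>?T \<noteq> {}\<close>
      by (intro cSup_least) (auto intro: less_imp_le)
    have intS: "integrable R (\<lambda>a. indicator S a * (r a - c))"
      using int_ind[of S] int_const[of S] by (simp add: right_diff_distrib)
    have intT: "integrable R (\<lambda>a. indicator ?T a * (c - r a))"
      using int_ind[of ?T] int_const[of ?T] by (simp add: right_diff_distrib)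
    have eqS: "(\<integral>a. indicator S a * (r a - c) \<partial>R) = measure Q S - c * measure R S"
      using int_ind[of S] int_const[of S] by (simp add: right_diff_distrib Q_eq Int_absorb2)
    have eqT: "(\<integral>a. indicator ?T a * (c - r a) \<partial>R) = c * measure R ?T - measure Q ?T"
      using int_ind[of ?T] int_const[of ?T] by (simp add: right_diff_distrib Q_eq Int_absorb2)
    have nnS: "0 \<le> indicator S a * (r a - c)" for a
      using ge_c by (auto simp: indicator_def)
    have nnT: "0 \<le> indicator ?T a * (c - r a)" for a
      using le_c by (auto simp: indicator_def)
    let ?x = "measure Q S - c * measure R S" and ?y = "c * measure R ?T - measure Q ?T"
    have x: "0 \<le> ?x" unfolding eqS[symmetric] using nnS by (rule Bochner_Integration.integral_nonneg)
    have y: "0 \<le> ?y" unfolding eqT[symmetric] using nnT by (rule Bochner_Integration.integral_nonneg)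
    \<comment> \<open>\<open>?x\<close> and \<open>?y\<close> are the integrals of
      \<open>r - c\<close> over \<open>S\<close> and of \<open>c - r\<close> over \<open>?T\<close>.
      Weighting each by the \<open>R\<close>-mass of the opposite set cancels \<open>c\<close>. The
      right side is nonpositive by assumption, so both nonnegative products vanish.\<close>
    have sum: "?x * measure R ?T + ?y * measure R S = measure Q S - measure R S"
      unfolding RT QT by (simp add: algebra_simps)
    have prods: "0 \<le> ?x * measure R ?T" "0 \<le> ?y * measure R S"
      using x y by simp_all
    have "?x * measure R ?T = 0" "?y * measure R S = 0"
      using sum prods le by linarith+
    then have "?x = 0" "?y = 0"
      using pos RT by auto
    then have "AE a in R. indicator S a * (r a - c) = 0" "AE a in R. indicator ?T a * (c - r a) = 0"
      using integral_nonneg_eq_0_iff_AE[OF intS] integral_nonneg_eq_0_iff_AE[OF intT] nnS nnT eqS eqT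
      by auto
    then have aeq: "AE a in R. r a = c"
      using AE_space by eventually_elim (auto simp: indicator_def split: if_splits)
    \<comment> \<open>An almost everywhere identity is attained somewhere in each set of positive
      measure. One such point in \<open>S\<close> and one in \<open>?T\<close> share the value
      \<open>c\<close>, against the strict separation.\<close>
    have ex: "\<exists>a\<in>A. r a = c" if [measurable]: "A \<in> sets R" and "0 < measure R A" for A
    proof (rule ccontr)
      assume "\<not> (\<exists>a\<in>A. r a = c)"
      then have "AE a in R. a \<notin> A" using aeq by (auto elim: eventually_mono)
      then have "measure R A = 0"
        by (simp add: R.prob_eq_0)
      with that show False by simp
    qed
    obtain a b where "a \<in> S" "b \<in> ?T" "r a = c" "r b = c"
      using ex[of S] ex[of ?T] pos RT by auto
    with above[of a b] show False by simp
  qed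
  have null: "measure Q A = 0" if [measurable]: "A \<in> sets R" and "measure R A = 0" for A
  proof -
    have "AE a in R. a \<notin> A" using that by (simp add: R.prob_eq_0)
    then have "(\<integral>a. indicator A a * r a \<partial>R) = (\<integral>a. 0 \<partial>R)"
      by (intro integral_cong_AE) (auto elim: eventually_mono)
    then show ?thesis by (simp add: Q_eq)
  qed
  have zero: "measure Q S = 0" if "measure R S = 0"
    using null[OF S that] .
  have one: "measure Q S = 1" if "measure R S = 1"
    using null[of "space R - S"] that R.prob_compl[OF S] Q.prob_compl[of S] by simp
  have cases: "measure R S = 0 \<or> measure R S = 1 \<or> 0 < measure R S \<and> measure R S < 1"
    using R.prob_le_1[of S] measure_nonneg[of R S] by linarith
  then show "measure R S \<le> measure Q S"
    using zero one strict by fastforce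
  show "measure R S < measure Q S \<longleftrightarrow> 0 < measure R S \<and> measure R S < 1"
    using cases zero one strict by fastforce
qed

section \<open>The Bayesian model: prior, posterior and prior predictive\<close>

locale bayes_model =
  fixes \<mu> :: "'x measure" and \<upsilon> :: "'p measure" and f :: "'p \<Rightarrow> 'x \<Rightarrow> real" and p :: "'p \<Rightarrow> real"
  assumes sigma_finite_sample: "sigma_finite_measure \<mu>"
    and likelihood_measurable: "(\<lambda>(\<theta>, x). f \<theta> x) \<in> borel_measurable (\<upsilon> \<Otimes>\<^sub>M \<mu>)"
    and likelihood_nonneg: "\<And>\<theta> x. \<theta> \<in> space \<upsilon> \<Longrightarrow> x \<in> space \<mu> \<Longrightarrow> 0 \<le> f \<theta> x"
    and prob_space_model: "\<And>\<theta>. \<theta> \<in> space \<upsilon> \<Longrightarrow> prob_space (model \<mu> f \<theta>)"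
    and prior_density_measurable [measurable]: "p \<in> borel_measurable \<upsilon>"
    and prior_density_nonneg: "\<And>\<theta>. \<theta> \<in> space \<upsilon> \<Longrightarrow> 0 \<le> p \<theta>"
    and prob_space_prior: "prob_space (prior \<upsilon> p)"
begin

abbreviation "pri \<equiv> prior \<upsilon> p"
abbreviation "pred \<equiv> predictive_density \<upsilon> p f"
abbreviation "post \<equiv> posterior \<upsilon> p f"
abbreviation "marg \<equiv> prior_predictive \<mu> \<upsilon> p f"

sublocale \<mu>: sigma_finite_measure \<mu> by (rule sigma_finite_sample)
sublocale pri: prob_space pri by (rule prob_space_prior)
text \<open>Tonelli is applied to the prior itself, which is a probability measure, and not to its
  support measure. This is why integrals over \<open>\<upsilon>\<close> are rewritten below as
  integrals over \<open>pri\<close>.\<close>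

sublocale pri_\<mu>: pair_sigma_finite pri \<mu> ..

lemma sets_prior [simp, measurable_cong]: "sets pri = sets \<upsilon>"
  and space_prior [simp]: "space pri = space \<upsilon>"
  by (simp_all add: prior_def)

lemma sets_model [simp, measurable_cong]: "sets (model \<mu> f \<theta>) = sets \<mu>"
  and space_model [simp]: "space (model \<mu> f \<theta>) = space \<mu>"
  by (simp_all add: model_def)

lemma sets_posterior [simp, measurable_cong]: "sets (post x) = sets \<upsilon>"
  and space_posterior [simp]: "space (post x) = space \<upsilon>"
  by (simp_all add: posterior_def)

lemma sets_prior_predictive [simp, measurable_cong]: "sets marg = sets \<mu>"
  and space_prior_predictive [simp]: "space marg = space \<mu>"
  by (simp_all add: prior_predictive_def)

lemma likelihood_measurable_prior [measurable]:
  "(\<lambda>(\<theta>, x). f \<theta> x) \<in> borel_measurable (pri \<Otimes>\<^sub>M \<mu>)"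
  using likelihood_measurable by (simp cong: measurable_cong_sets sets_pair_measure_cong)

lemma likelihood_section_measurable [measurable]:
  "x \<in> space \<mu> \<Longrightarrow> (\<lambda>\<theta>. f \<theta> x) \<in> borel_measurable \<upsilon>"
  "\<theta> \<in> space \<upsilon> \<Longrightarrow> f \<theta> \<in> borel_measurable \<mu>"
  using measurable_Pair_compose_split[OF likelihood_measurable] by measurable

lemma nn_integral_prior:
  assumes [measurable]: "h \<in> borel_measurable \<upsilon>"
  shows "(\<integral>\<^sup>+\<theta>. h \<theta> \<partial>pri) = (\<integral>\<^sup>+\<theta>. ennreal (p \<theta>) * h \<theta> \<partial>\<upsilon>)"
  unfolding prior_def by (intro nn_integral_density) auto

lemma predictive_density_eq:
  assumes [measurable]: "x \<in> space \<mu>"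
  shows "pred x = (\<integral>\<^sup>+\<theta>. ennreal (f \<theta> x) \<partial>pri)"
  unfolding predictive_density_def using assms
  by (subst nn_integral_prior)
     (auto intro!: nn_integral_cong simp: ennreal_mult prior_density_nonneg likelihood_nonneg)

lemma predictive_density_measurable [measurable]: "pred \<in> borel_measurable \<mu>"
proof -
  have "(\<lambda>x. \<integral>\<^sup>+\<theta>. ennreal (f \<theta> x) \<partial>pri) \<in> borel_measurable \<mu>"
    by measurable
  then show ?thesis
    by (simp add: predictive_density_eq cong: measurable_cong)
qed

text \<open>The posterior has density \<open>f \<theta> x / pred x\<close> with respect to the
  prior. The identity of integrands is pure \<open>ennreal\<close> algebra, so it also holds where
  \<open>pred x\<close> is zero or infinite.\<close>

lemma nn_integral_posterior:
  assumes [measurable]: "x \<in> space \<mu>" "h \<in> borel_measurable \<upsilon>"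
  shows "(\<integral>\<^sup>+\<theta>. h \<theta> \<partial>post x) = (\<integral>\<^sup>+\<theta>. ennreal (f \<theta> x) / pred x * h \<theta> \<partial>pri)"
proof -
  have "(\<integral>\<^sup>+\<theta>. h \<theta> \<partial>post x) = (\<integral>\<^sup>+\<theta>. ennreal (p \<theta> * f \<theta> x) / pred x * h \<theta> \<partial>\<upsilon>)"
    unfolding posterior_def by (intro nn_integral_density) auto
  also have "\<dots> = (\<integral>\<^sup>+\<theta>. ennreal (p \<theta>) * (ennreal (f \<theta> x) / pred x * h \<theta>) \<partial>\<upsilon>)"
    using assms(1) by (intro nn_integral_cong)
      (simp add: ennreal_mult prior_density_nonneg likelihood_nonneg ennreal_times_divide mult.assoc[symmetric])
  finally show ?thesis
    by (simp add: nn_integral_prior)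
qed

text \<open>The general index space \<open>N\<close> is for integrands that depend on more than the
  observation: membership in the region is a condition on pairs \<open>(x, \<tau>)\<close>, handled
  with \<open>N\<close> a product and \<open>X\<close> the first projection.\<close>

lemma nn_integral_posterior_measurable [measurable (raw)]:
  assumes [measurable]: "(\<lambda>(y, \<theta>). h y \<theta>) \<in> borel_measurable (N \<Otimes>\<^sub>M \<upsilon>)"
    and X [measurable]: "X \<in> measurable N \<mu>"
  shows "(\<lambda>y. \<integral>\<^sup>+\<theta>. h y \<theta> \<partial>post (X y)) \<in> borel_measurable N"
proof -
  have [measurable]: "(\<lambda>(y, \<theta>). h y \<theta>) \<in> borel_measurable (N \<Otimes>\<^sub>M pri)"
    using assms(1) by (simp cong: measurable_cong_sets sets_pair_measure_cong)
  have "(\<lambda>y. \<integral>\<^sup>+\<theta>. ennreal (f \<theta> (X y)) / pred (X y) * h y \<theta> \<partial>pri) \<in> borel_measurable N"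
    by measurable
  moreover have "(\<integral>\<^sup>+\<theta>. h y \<theta> \<partial>post (X y))
      = (\<integral>\<^sup>+\<theta>. ennreal (f \<theta> (X y)) / pred (X y) * h y \<theta> \<partial>pri)" if [measurable]: "y \<in> space N" for y
    using measurable_space[OF X that] by (intro nn_integral_posterior) measurable
  ultimately show ?thesis
    by (simp cong: measurable_cong)
qed

lemma nn_integral_model:
  assumes [measurable]: "\<theta> \<in> space \<upsilon>" "h \<in> borel_measurable \<mu>"
  shows "(\<integral>\<^sup>+x. h x \<partial>model \<mu> f \<theta>) = (\<integral>\<^sup>+x. ennreal (f \<theta> x) * h x \<partial>\<mu>)"
  unfolding model_def by (intro nn_integral_density) auto

lemma nn_integral_prior_model:
  assumes h [measurable]: "(\<lambda>(\<theta>, x). h \<theta> x) \<in> borel_measurable (pri \<Otimes>\<^sub>M \<mu>)"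
  shows "(\<integral>\<^sup>+\<theta>. \<integral>\<^sup>+x. h \<theta> x \<partial>model \<mu> f \<theta> \<partial>pri)
    = (\<integral>\<^sup>+x. \<integral>\<^sup>+\<theta>. ennreal (f \<theta> x) * h \<theta> x \<partial>pri \<partial>\<mu>)"
proof -
  have "(\<integral>\<^sup>+\<theta>. \<integral>\<^sup>+x. h \<theta> x \<partial>model \<mu> f \<theta> \<partial>pri)
    = (\<integral>\<^sup>+\<theta>. \<integral>\<^sup>+x. ennreal (f \<theta> x) * h \<theta> x \<partial>\<mu> \<partial>pri)"
    by (intro nn_integral_cong nn_integral_model) auto
  also have "\<dots> = (\<integral>\<^sup>+x. \<integral>\<^sup>+\<theta>. ennreal (f \<theta> x) * h \<theta> x \<partial>pri \<partial>\<mu>)"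
    by (intro pri_\<mu>.Fubini'[symmetric]) auto
  finally show ?thesis .
qed

text \<open>Tonelli with integrand 1: every model measure has mass one, and so has the
  prior.\<close>

lemma nn_integral_predictive_density: "(\<integral>\<^sup>+x. pred x \<partial>\<mu>) = 1"
proof -
  have "(\<integral>\<^sup>+x. pred x \<partial>\<mu>) = (\<integral>\<^sup>+x. \<integral>\<^sup>+\<theta>. ennreal (f \<theta> x) * 1 \<partial>pri \<partial>\<mu>)"
    by (intro nn_integral_cong) (simp add: predictive_density_eq)
  also have "\<dots> = (\<integral>\<^sup>+\<theta>. \<integral>\<^sup>+x. 1 \<partial>model \<mu> f \<theta> \<partial>pri)"
    by (rule nn_integral_prior_model[symmetric]) auto
  also have "\<dots> = (\<integral>\<^sup>+\<theta>. 1 \<partial>pri)"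
    using prob_space.emeasure_space_1[OF prob_space_model] by (intro nn_integral_cong) simp
  finally show ?thesis
    using pri.emeasure_space_1 by simp
qed

sublocale marg: prob_space marg
proof
  show "emeasure marg (space marg) = 1"
    using nn_integral_predictive_density
    by (simp add: prior_predictive_def emeasure_density cong: nn_integral_cong)
qed

lemma AE_predictive_density_finite: "AE x in \<mu>. pred x \<noteq> \<infinity>"
  using nn_integral_predictive_density by (intro nn_integral_noteq_infinite) auto

text \<open>The mass of the posterior is \<open>pred x / pred x\<close>, which is 1 when
  \<open>pred x\<close> is positive and finite. Infinite values form a \<open>\<mu>\<close>-null
  set, and the zeros of its own density are null for \<open>marg\<close>.\<close>

lemma AE_prob_space_posterior: "AE x in marg. prob_space (post x)"
proof -
  have "AE x in \<mu>. 0 < pred x \<longrightarrow> prob_space (post x)"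
    using AE_predictive_density_finite AE_space
  proof eventually_elim
    case (elim x)
    note [measurable] = elim(2)
    show ?case
    proof
      assume "0 < pred x"
      have "emeasure (post x) (space (post x)) = (\<integral>\<^sup>+\<theta>. ennreal (f \<theta> x) / pred x * 1 \<partial>pri)"
        using nn_integral_posterior[of x "\<lambda>_. 1"] elim by simp
      also have "\<dots> = pred x / pred x"
        using elim by (simp add: nn_integral_divide predictive_density_eq)
      also have "\<dots> = 1"
        using \<open>0 < pred x\<close> elim by (simp add: ennreal_divide_self less_top)
      finally show "prob_space (post x)" by (rule prob_spaceI)
    qed
  qed
  then show ?thesis
    unfolding prior_predictive_def by (subst AE_density) auto
qed

section \<open>Disintegration of the joint distribution\<close>

text \<open>Bayes' formula: the joint law of parameter and observation is generated either from the
  prior and the model or from the prior predictive and the posterior, because \<open>pred x\<close>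
  cancels in the product of the last two densities.\<close>

lemma nn_integral_disintegration:
  assumes h [measurable]: "(\<lambda>(\<theta>, x). h \<theta> x) \<in> borel_measurable (pri \<Otimes>\<^sub>M \<mu>)"
  shows "(\<integral>\<^sup>+\<theta>. \<integral>\<^sup>+x. h \<theta> x \<partial>model \<mu> f \<theta> \<partial>pri) = (\<integral>\<^sup>+x. \<integral>\<^sup>+\<theta>. h \<theta> x \<partial>post x \<partial>marg)"
proof -
  have h1 [measurable]: "(\<lambda>\<theta>. h \<theta> x) \<in> borel_measurable \<upsilon>" if [measurable]: "x \<in> space \<mu>" for x
  proof -
    have "(\<lambda>\<theta>. h \<theta> x) \<in> borel_measurable pri" by measurable
    then show ?thesis by (simp cong: measurable_cong_sets)
  qed
  have post_meas [measurable]: "(\<lambda>x. \<integral>\<^sup>+\<theta>. h \<theta> x \<partial>post x) \<in> borel_measurable \<mu>"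
  proof -
    have "(\<lambda>x. \<integral>\<^sup>+\<theta>. ennreal (f \<theta> x) / pred x * h \<theta> x \<partial>pri) \<in> borel_measurable \<mu>"
      by measurable
    then show ?thesis
      by (simp add: nn_integral_posterior cong: measurable_cong)
  qed
  have "(\<integral>\<^sup>+x. \<integral>\<^sup>+\<theta>. h \<theta> x \<partial>post x \<partial>marg) = (\<integral>\<^sup>+x. pred x * (\<integral>\<^sup>+\<theta>. h \<theta> x \<partial>post x) \<partial>\<mu>)"
    unfolding prior_predictive_def by (rule nn_integral_density) auto
  also have "\<dots> = (\<integral>\<^sup>+x. \<integral>\<^sup>+\<theta>. ennreal (f \<theta> x) * h \<theta> x \<partial>pri \<partial>\<mu>)"
  proof (intro nn_integral_cong_AE)
    show "AE x in \<mu>. pred x * (\<integral>\<^sup>+\<theta>. h \<theta> x \<partial>post x) = (\<integral>\<^sup>+\<theta>. ennreal (f \<theta> x) * h \<theta> x \<partial>pri)"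
      using AE_predictive_density_finite AE_space
    proof eventually_elim
      case (elim x)
      note [measurable] = elim(2)
      show ?case
      proof (cases "pred x = 0")
        case True
        \<comment> \<open>No cancellation is possible here; instead the likelihood vanishes for
          almost every parameter, and both sides are zero.\<close>
        then have "AE \<theta> in pri. ennreal (f \<theta> x) = 0"
          using elim by (simp add: predictive_density_eq nn_integral_0_iff_AE)
        then have "(\<integral>\<^sup>+\<theta>. ennreal (f \<theta> x) * h \<theta> x \<partial>pri) = (\<integral>\<^sup>+\<theta>. 0 \<partial>pri)"
          by (intro nn_integral_cong_AE) (auto elim: eventually_mono)
        with True show ?thesis by simp
      next
        case False
        have "pred x * (\<integral>\<^sup>+\<theta>. h \<theta> x \<partial>post x)
            = (\<integral>\<^sup>+\<theta>. pred x * (ennreal (f \<theta> x) / pred x * h \<theta> x) \<partial>pri)"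
          using elim by (simp add: nn_integral_posterior nn_integral_cmult)
        also have "\<dots> = (\<integral>\<^sup>+\<theta>. ennreal (f \<theta> x) * h \<theta> x \<partial>pri)"
        proof (intro nn_integral_cong)
          fix \<theta>
          have "pred x * (ennreal (f \<theta> x) / pred x) = ennreal (f \<theta> x)"
            using False elim by (simp add: ennreal_times_divide mult.commute ennreal_mult_divide_eq)
          then show "pred x * (ennreal (f \<theta> x) / pred x * h \<theta> x) = ennreal (f \<theta> x) * h \<theta> x"
            by (simp add: mult.assoc[symmetric])
        qed
        finally show ?thesis .
      qed
    qed
  qed
  also have "\<dots> = (\<integral>\<^sup>+\<theta>. \<integral>\<^sup>+x. h \<theta> x \<partial>model \<mu> f \<theta> \<partial>pri)"
    by (rule nn_integral_prior_model[OF h, symmetric])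
  finally show ?thesis by simp
qed

text \<open>The bounds 0 and 1 on \<open>h\<close> make the inner integrals finite, for the
  posterior at least almost everywhere, so passing through \<open>enn2real\<close> loses
  nothing.\<close>

lemma integral_disintegration:
  fixes h :: "'p \<Rightarrow> 'x \<Rightarrow> real"
  assumes h: "(\<lambda>(\<theta>, x). h \<theta> x) \<in> borel_measurable (\<upsilon> \<Otimes>\<^sub>M \<mu>)"
    and nonneg: "\<And>\<theta> x. 0 \<le> h \<theta> x" and le_1: "\<And>\<theta> x. h \<theta> x \<le> 1"
  shows "(\<integral>\<theta>. \<integral>x. h \<theta> x \<partial>model \<mu> f \<theta> \<partial>pri) = (\<integral>x. \<integral>\<theta>. h \<theta> x \<partial>post x \<partial>marg)"
proof -
  note [measurable] = h
  have [measurable]: "(\<lambda>(\<theta>, x). h \<theta> x) \<in> borel_measurable (pri \<Otimes>\<^sub>M \<mu>)"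
    using h by (simp cong: measurable_cong_sets sets_pair_measure_cong)
  have sections [measurable]: "\<theta> \<in> space \<upsilon> \<Longrightarrow> h \<theta> \<in> borel_measurable \<mu>"
    "x \<in> space \<mu> \<Longrightarrow> (\<lambda>\<theta>. h \<theta> x) \<in> borel_measurable \<upsilon>" for x \<theta>
    by measurable
  define K where "K \<theta> = (\<integral>\<^sup>+x. h \<theta> x \<partial>model \<mu> f \<theta>)" for \<theta>
  define J where "J x = (\<integral>\<^sup>+\<theta>. h \<theta> x \<partial>post x)" for x
  have K_meas [measurable]: "K \<in> borel_measurable pri"
  proof -
    have "(\<lambda>\<theta>. \<integral>\<^sup>+x. ennreal (f \<theta> x) * h \<theta> x \<partial>\<mu>) \<in> borel_measurable pri"
      by measurable
    moreover have "K \<theta> = (\<integral>\<^sup>+x. ennreal (f \<theta> x) * h \<theta> x \<partial>\<mu>)" if [measurable]: "\<theta> \<in> space pri" for \<theta>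
      unfolding K_def using that by (intro nn_integral_model) auto
    ultimately show ?thesis
      by (subst measurable_cong) auto
  qed
  have J_meas [measurable]: "J \<in> borel_measurable marg"
    unfolding J_def by measurable
  have bounded: "(\<integral>\<^sup>+a. ennreal (g a) \<partial>N) < \<infinity>" if "prob_space N" "\<And>a. g a \<le> 1"
    for g :: "'b \<Rightarrow> real" and N
  proof -
    have "(\<integral>\<^sup>+a. ennreal (g a) \<partial>N) \<le> (\<integral>\<^sup>+a. 1 \<partial>N)"
      using that by (intro nn_integral_mono) simp
    also have "\<dots> < \<infinity>"
      using prob_space.emeasure_space_1[OF that(1)] by simp
    finally show ?thesis .
  qed
  have K_fin: "AE \<theta> in pri. K \<theta> < \<infinity>"
    using bounded[OF prob_space_model le_1] by (auto simp: K_def)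
  have J_fin: "AE x in marg. J x < \<infinity>"
    using AE_prob_space_posterior bounded[OF _ le_1] by (auto simp: J_def elim!: eventually_mono)
  have "(\<integral>\<theta>. \<integral>x. h \<theta> x \<partial>model \<mu> f \<theta> \<partial>pri) = (\<integral>\<theta>. enn2real (K \<theta>) \<partial>pri)"
    unfolding K_def using nonneg
    by (intro Bochner_Integration.integral_cong integral_eq_nn_integral) (auto intro: sections)
  also have "\<dots> = enn2real (\<integral>\<^sup>+\<theta>. K \<theta> \<partial>pri)"
    using K_fin by (subst integral_eq_nn_integral)
      (auto intro!: arg_cong[where f=enn2real] nn_integral_cong_AE elim!: eventually_mono)
  also have "(\<integral>\<^sup>+\<theta>. K \<theta> \<partial>pri) = (\<integral>\<^sup>+x. J x \<partial>marg)"
    unfolding K_def J_def by (intro nn_integral_disintegration) measurable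
  also have "enn2real \<dots> = (\<integral>x. enn2real (J x) \<partial>marg)"
    using J_fin by (subst integral_eq_nn_integral)
      (auto intro!: arg_cong[where f=enn2real] nn_integral_cong_AE elim!: eventually_mono)
  also have "\<dots> = (\<integral>x. \<integral>\<theta>. h \<theta> x \<partial>post x \<partial>marg)"
    unfolding J_def using nonneg
    by (intro Bochner_Integration.integral_cong integral_eq_nn_integral[symmetric]) (auto intro: sections)
  finally show ?thesis .
qed

end

section \<open>Comparison of the two coverage probabilities\<close>

text \<open>The weak inequality comes with an exact criterion for strictness, since equality can
  occur: for \<open>\<gamma> = 1\<close> the region is the whole space for almost every observation,
  and both sides equal 1.\<close>

theorem theorem9:
  fixes \<mu> :: "'x measure" and \<upsilon> :: "'p measure" and \<nu> :: "'t measure"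
    and f :: "'p \<Rightarrow> 'x \<Rightarrow> real" and p :: "'p \<Rightarrow> real" and \<Upsilon> :: "'p \<Rightarrow> 't"
    and q :: "'t \<Rightarrow> real" and qx :: "'x \<Rightarrow> 't \<Rightarrow> real" and \<gamma> :: real
  defines "P \<equiv> model \<mu> f"
    and "\<pi> \<equiv> prior \<upsilon> p"
    and "\<pi>\<Upsilon> \<equiv> marginal_prior \<upsilon> p \<nu> \<Upsilon>"
    and "Q \<equiv> marginal_posterior \<upsilon> p f \<nu> \<Upsilon>"
    and "M \<equiv> prior_predictive \<mu> \<upsilon> p f"
    and "C \<equiv> relative_surprise_region \<nu> (marginal_posterior \<upsilon> p f \<nu> \<Upsilon>) q qx \<gamma>"
  assumes "sigma_finite_measure \<mu>"
    and "(\<lambda>(\<theta>, x). f \<theta> x) \<in> borel_measurable (\<upsilon> \<Otimes>\<^sub>M \<mu>)"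
    and "\<And>\<theta> x. \<theta> \<in> space \<upsilon> \<Longrightarrow> x \<in> space \<mu> \<Longrightarrow> 0 \<le> f \<theta> x"
    and "\<And>\<theta>. \<theta> \<in> space \<upsilon> \<Longrightarrow> prob_space (P \<theta>)"
    and "p \<in> borel_measurable \<upsilon>"
    and "\<And>\<theta>. \<theta> \<in> space \<upsilon> \<Longrightarrow> 0 \<le> p \<theta>"
    and "prob_space \<pi>"
    and "\<Upsilon> \<in> measurable \<upsilon> \<nu>"
    and "q \<in> borel_measurable \<nu>"
    and "\<And>\<tau>. \<tau> \<in> space \<nu> \<Longrightarrow> 0 < q \<tau>"
    and "\<pi>\<Upsilon> = density \<nu> (\<lambda>\<tau>. ennreal (q \<tau>))"
    and "(\<lambda>(x, \<tau>). qx x \<tau>) \<in> borel_measurable (\<mu> \<Otimes>\<^sub>M \<nu>)"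
    and "\<And>x \<tau>. x \<in> space \<mu> \<Longrightarrow> \<tau> \<in> space \<nu> \<Longrightarrow> 0 \<le> qx x \<tau>"
    and "AE x in M. Q x = density \<nu> (\<lambda>\<tau>. ennreal (qx x \<tau>))"
    and "0 \<le> \<gamma>" and "\<gamma> \<le> 1"
  shows "(\<integral>\<theta>. (\<integral>\<tau>. measure (P \<theta>) {x \<in> space \<mu>. \<tau> \<in> C x} \<partial>\<pi>\<Upsilon>) \<partial>\<pi>)
           \<le> (\<integral>\<theta>. measure (P \<theta>) {x \<in> space \<mu>. \<Upsilon> \<theta> \<in> C x} \<partial>\<pi>)
       \<and> ((\<integral>\<theta>. (\<integral>\<tau>. measure (P \<theta>) {x \<in> space \<mu>. \<tau> \<in> C x} \<partial>\<pi>\<Upsilon>) \<partial>\<pi>)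
           < (\<integral>\<theta>. measure (P \<theta>) {x \<in> space \<mu>. \<Upsilon> \<theta> \<in> C x} \<partial>\<pi>)
         \<longleftrightarrow> 0 < measure M {x \<in> space \<mu>. 0 < measure \<pi>\<Upsilon> (C x) \<and> measure \<pi>\<Upsilon> (C x) < 1})"
proof -
  interpret bayes_model \<mu> \<upsilon> f p
    using assms(7-13) unfolding P_def \<pi>_def by (intro bayes_model.intro)
  note [measurable] = assms(14,15,18)
  have q_pos: "0 < q \<tau>" if "\<tau> \<in> space \<nu>" for \<tau> using that by (rule assms(16))
  have rho_eq: "\<pi>\<Upsilon> = density \<nu> (\<lambda>\<tau>. ennreal (q \<tau>))" by fact
  have \<Upsilon>_pri [measurable]: "\<Upsilon> \<in> measurable pri \<nu>"
    using assms(14) by (simp cong: measurable_cong_sets)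
  interpret \<rho>: prob_space \<pi>\<Upsilon>
    unfolding \<pi>\<Upsilon>_def marginal_prior_def by (rule pri.prob_space_distr) measurable
  have sets_rho [simp, measurable_cong]: "sets \<pi>\<Upsilon> = sets \<nu>" and space_rho [simp]: "space \<pi>\<Upsilon> = space \<nu>"
    by (simp_all add: rho_eq)
  have sets_Q [simp]: "sets (Q x) = sets \<nu>" and space_Q [simp]: "space (Q x) = space \<nu>" for x
    by (simp_all add: Q_def marginal_posterior_def)
  have \<Upsilon>_post [measurable]: "\<Upsilon> \<in> measurable (post x) \<nu>" for x
    using assms(14) by (simp cong: measurable_cong_sets)
  define r where "r x \<tau> = qx x \<tau> / q \<tau>" for x \<tau>
  have r_meas [measurable]: "(\<lambda>(x, \<tau>). r x \<tau>) \<in> borel_measurable (\<mu> \<Otimes>\<^sub>M \<nu>)"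
    unfolding r_def by measurable
  have C_iff: "\<tau> \<in> C x \<longleftrightarrow> \<tau> \<in> space \<nu> \<and> measure (Q x) {\<tau>' \<in> space \<nu>. r x \<tau> < r x \<tau>'} \<le> \<gamma>" for x \<tau>
    by (simp add: C_def relative_surprise_region_def Q_def r_def)
  have C_subset: "C x \<subseteq> space \<nu>" for x by (auto simp: C_iff)
  \<comment> \<open>Posterior probabilities become integrals over \<open>post x\<close>, whose
    measurability in \<open>x\<close> is already established.\<close>
  have Q_eq: "measure (Q x) A = enn2real (\<integral>\<^sup>+\<theta>. indicator A (\<Upsilon> \<theta>) \<partial>post x)"
    if [measurable]: "A \<in> sets \<nu>" for x A
  proof -
    have "emeasure (Q x) A = (\<integral>\<^sup>+\<tau>. indicator A \<tau> \<partial>Q x)"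
      by simp
    also have "\<dots> = (\<integral>\<^sup>+\<theta>. indicator A (\<Upsilon> \<theta>) \<partial>post x)"
      unfolding Q_def marginal_posterior_def by (intro nn_integral_distr) auto
    finally show ?thesis
      by (simp add: measure_def)
  qed
  have C_meas [measurable]: "Measurable.pred (\<mu> \<Otimes>\<^sub>M \<nu>) (\<lambda>(x, \<tau>). \<tau> \<in> C x)"
  proof -
    \<comment> \<open>Joint measurability of the region: \<open>G\<close> is the posterior mass of
      the values more surprising than \<open>snd y\<close>, with an integrand jointly measurable in
      \<open>y\<close> and \<open>\<theta>\<close>. The region is the set where its real value is at
      most \<open>\<gamma>\<close>.\<close>
    define G where "G y = (\<integral>\<^sup>+\<theta>. indicator {\<tau> \<in> space \<nu>. r (fst y) (snd y) < r (fst y) \<tau>} (\<Upsilon> \<theta>)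
      \<partial>post (fst y))" for y
    have G_meas: "Measurable.pred (\<mu> \<Otimes>\<^sub>M \<nu>) (\<lambda>y. enn2real (G y) \<le> \<gamma>)"
      unfolding G_def by measurable
    have G_iff: "(\<lambda>(x, \<tau>). \<tau> \<in> C x) y \<longleftrightarrow> enn2real (G y) \<le> \<gamma>"
      if y_space: "y \<in> space (\<mu> \<Otimes>\<^sub>M \<nu>)" for y
    proof -
      obtain x \<tau> where y: "y = (x, \<tau>)" "x \<in> space \<mu>" "\<tau> \<in> space \<nu>"
        using y_space by (auto simp: space_pair_measure)
      note [measurable] = y(2,3)
      have "{\<tau>' \<in> space \<nu>. r x \<tau> < r x \<tau>'} \<in> sets \<nu>" by measurable
      then show ?thesis
        using y by (simp add: C_iff Q_eq G_def)
    qed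
    show ?thesis
      by (rule iffD2[OF measurable_cong[OF G_iff] G_meas])
  qed
  have C_sets [measurable]: "C x \<in> sets \<nu>" if [measurable]: "x \<in> space \<mu>" for x
  proof -
    have "{\<tau> \<in> space \<nu>. \<tau> \<in> C x} \<in> sets \<nu>" by measurable
    also have "{\<tau> \<in> space \<nu>. \<tau> \<in> C x} = C x" using C_subset by auto
    finally show ?thesis .
  qed
  define \<alpha> where "\<alpha> x = measure \<pi>\<Upsilon> (C x)" for x
  define \<beta> where "\<beta> x = measure (Q x) (C x)" for x
  have \<alpha>_int: "\<alpha> x = (\<integral>\<tau>. indicator (C x) \<tau> \<partial>\<pi>\<Upsilon>)" if "x \<in> space \<mu>" for x
    using C_sets[OF that] by (simp add: \<alpha>_def Int_absorb2 C_subset)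
  have \<beta>_int: "\<beta> x = (\<integral>\<theta>. indicator (C x) (\<Upsilon> \<theta>) \<partial>post x)" if [measurable]: "x \<in> space \<mu>" for x
    unfolding \<beta>_def Q_eq[OF C_sets[OF that]]
    by (subst integral_eq_nn_integral) (auto simp: ennreal_indicator)
  have \<alpha>_meas [measurable]: "\<alpha> \<in> borel_measurable \<mu>"
  proof -
    have "(\<lambda>x. \<integral>\<tau>. indicator (C x) \<tau> \<partial>\<pi>\<Upsilon> :: real) \<in> borel_measurable \<mu>"
      by measurable
    from iffD2[OF measurable_cong[OF \<alpha>_int] this] show ?thesis .
  qed
  have \<beta>_meas [measurable]: "\<beta> \<in> borel_measurable \<mu>"
  proof -
    have "(\<lambda>x. enn2real (\<integral>\<^sup>+\<theta>. indicator (C x) (\<Upsilon> \<theta>) \<partial>post x)) \<in> borel_measurable \<mu>"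
      by measurable
    moreover have "\<beta> x = enn2real (\<integral>\<^sup>+\<theta>. indicator (C x) (\<Upsilon> \<theta>) \<partial>post x)" if "x \<in> space \<mu>" for x
      unfolding \<beta>_def by (rule Q_eq[OF C_sets[OF that]])
    ultimately show ?thesis by (subst measurable_cong) auto
  qed
  \<comment> \<open>Both the unit mass of \<open>Q x\<close> and its density \<open>qx x\<close> are
    available only off a null set of the prior predictive.\<close>
  have pointwise: "AE x in M. prob_space (Q x) \<and> \<alpha> x \<le> \<beta> x \<and> (\<alpha> x < \<beta> x \<longleftrightarrow> 0 < \<alpha> x \<and> \<alpha> x < 1)"
    using AE_prob_space_posterior[folded M_def] assms(20) AE_space
  proof eventually_elim
    case (elim x)
    then have [measurable]: "x \<in> space \<mu>" by (simp add: M_def)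
    have probQ: "prob_space (Q x)"
      unfolding Q_def marginal_posterior_def using elim(1) by (rule prob_space.prob_space_distr) measurable
    have [measurable]: "r x \<in> borel_measurable \<nu>" by measurable
    have Q_r: "Q x = density \<pi>\<Upsilon> (\<lambda>\<tau>. ennreal (r x \<tau>))"
    proof -
      have "density \<pi>\<Upsilon> (\<lambda>\<tau>. ennreal (r x \<tau>)) = density \<nu> (\<lambda>\<tau>. ennreal (q \<tau>) * ennreal (r x \<tau>))"
        unfolding rho_eq by (rule density_density_eq) auto
      also have "\<dots> = density \<nu> (\<lambda>\<tau>. ennreal (qx x \<tau>))"
        using q_pos assms(19)[OF \<open>x \<in> space \<mu>\<close>]
        by (intro density_cong AE_I2) (auto simp: r_def ennreal_mult[symmetric] less_imp_le less_imp_neq[symmetric])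
      finally show ?thesis using elim(2) by simp
    qed
    have above: "r x b < r x a" if "a \<in> C x" "b \<in> space \<pi>\<Upsilon> - C x" for a b
    proof (rule ccontr)
      assume "\<not> r x b < r x a"
      \<comment> \<open>If \<open>r x a \<le> r x b\<close>, the values with ratio above
        \<open>r x b\<close> are among those with ratio above \<open>r x a\<close>, so
        \<open>b\<close> would enter the region along with \<open>a\<close>.\<close>
      then have "measure (Q x) {\<tau>' \<in> space \<nu>. r x b < r x \<tau>'} \<le> measure (Q x) {\<tau>' \<in> space \<nu>. r x a < r x \<tau>'}"
        using probQ by (intro finite_measure.finite_measure_mono prob_space.finite_measure) auto
      with that show False by (auto simp: C_iff)
    qed
    have "\<alpha> x \<le> \<beta> x" "\<alpha> x < \<beta> x \<longleftrightarrow> 0 < \<alpha> x \<and> \<alpha> x < 1"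
      unfolding \<alpha>_def \<beta>_def
      using upper_level_set_prob[OF \<rho>.prob_space_axioms probQ Q_r, of "C x"] above assms(19) q_pos
      by (auto simp: r_def less_imp_le \<open>x \<in> space \<mu>\<close>)
    with probQ show ?case by simp
  qed
  have lhs: "(\<integral>\<theta>. (\<integral>\<tau>. measure (P \<theta>) {x \<in> space \<mu>. \<tau> \<in> C x} \<partial>\<pi>\<Upsilon>) \<partial>\<pi>) = (\<integral>x. \<alpha> x \<partial>M)"
  proof -
    \<comment> \<open>For fixed \<open>\<theta>\<close> the independent value and the observation
      form a product distribution. Fubini integrates out the independent value first, leaving
      \<open>\<alpha>\<close>.\<close>
    have "(\<integral>\<tau>. measure (P \<theta>) {x \<in> space \<mu>. \<tau> \<in> C x} \<partial>\<pi>\<Upsilon>) = (\<integral>x. \<alpha> x \<partial>P \<theta>)" if \<theta>: "\<theta> \<in> space \<upsilon>" for \<theta>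
    proof -
      interpret P\<theta>: prob_space "P \<theta>" using \<theta> by (rule assms(10))
      interpret joint: pair_prob_space "P \<theta>" \<pi>\<Upsilon> ..
      have [measurable_cong]: "sets (P \<theta>) = sets \<mu>" by (simp add: P_def)
      have sp: "space (P \<theta>) = space \<mu>" by (simp add: P_def)
      have "integrable (P \<theta> \<Otimes>\<^sub>M \<pi>\<Upsilon>) (\<lambda>(x, \<tau>). indicator (C x) \<tau> :: real)"
        by (rule joint.integrable_const_bound[of _ 1]) (auto simp: indicator_def)
      from joint.Fubini_integral[OF this]
      have "(\<integral>\<tau>. \<integral>x. indicator (C x) \<tau> \<partial>P \<theta> \<partial>\<pi>\<Upsilon>) = (\<integral>x. \<integral>\<tau>. indicator (C x) \<tau> \<partial>\<pi>\<Upsilon> \<partial>P \<theta> :: real)" .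
      also have "\<dots> = (\<integral>x. \<alpha> x \<partial>P \<theta>)"
        by (intro Bochner_Integration.integral_cong) (auto simp: \<alpha>_int sp)
      also have "(\<integral>\<tau>. \<integral>x. indicator (C x) \<tau> \<partial>P \<theta> \<partial>\<pi>\<Upsilon>) = (\<integral>\<tau>. measure (P \<theta>) {x \<in> space \<mu>. \<tau> \<in> C x} \<partial>\<pi>\<Upsilon>)"
      proof (intro Bochner_Integration.integral_cong refl)
        fix \<tau> assume "\<tau> \<in> space \<pi>\<Upsilon>"
        have "(\<integral>x. indicator (C x) \<tau> \<partial>P \<theta>) = (\<integral>x. indicator {x \<in> space \<mu>. \<tau> \<in> C x} x \<partial>P \<theta> :: real)"
          by (intro Bochner_Integration.integral_cong) (auto simp: indicator_def sp)
        also have "\<dots> = measure (P \<theta>) {x \<in> space \<mu>. \<tau> \<in> C x}"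
          by (simp add: sp Int_absorb2)
        finally show "(\<integral>x. indicator (C x) \<tau> \<partial>P \<theta>) = measure (P \<theta>) {x \<in> space \<mu>. \<tau> \<in> C x}" .
      qed
      finally show ?thesis .
    qed
    then have "(\<integral>\<theta>. (\<integral>\<tau>. measure (P \<theta>) {x \<in> space \<mu>. \<tau> \<in> C x} \<partial>\<pi>\<Upsilon>) \<partial>\<pi>) = (\<integral>\<theta>. \<integral>x. \<alpha> x \<partial>model \<mu> f \<theta> \<partial>pri)"
      unfolding \<pi>_def P_def by (intro Bochner_Integration.integral_cong) auto
    also have "\<dots> = (\<integral>x. \<integral>\<theta>. \<alpha> x \<partial>post x \<partial>marg)"
    proof (rule integral_disintegration)
      show "(\<lambda>(\<theta>, x). \<alpha> x) \<in> borel_measurable (\<upsilon> \<Otimes>\<^sub>M \<mu>)" by measurable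
    qed (auto simp: \<alpha>_def)
    also have "\<dots> = (\<integral>x. \<alpha> x \<partial>M)"
    proof -
      \<comment> \<open>The integrand is constant in \<open>\<theta>\<close>, but the posterior has
        mass one only almost everywhere; hence the separate measurability claim for the
        congruence.\<close>
      have "AE x in marg. (\<integral>\<theta>. \<alpha> x \<partial>post x) = \<alpha> x"
        using AE_prob_space_posterior by eventually_elim (use prob_space.prob_space in fastforce)
      moreover have "(\<lambda>x. \<integral>\<theta>. \<alpha> x \<partial>post x) \<in> borel_measurable marg"
      proof -
        have "(\<lambda>x. enn2real (\<integral>\<^sup>+\<theta>. \<alpha> x \<partial>post x)) \<in> borel_measurable marg"
          by measurable
        moreover have "(\<integral>\<theta>. \<alpha> x \<partial>post x) = enn2real (\<integral>\<^sup>+\<theta>. \<alpha> x \<partial>post x)" for x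
          by (rule integral_eq_nn_integral) (auto simp: \<alpha>_def)
        ultimately show ?thesis by simp
      qed
      ultimately show ?thesis
        unfolding M_def by (intro integral_cong_AE) auto
    qed
    finally show ?thesis .
  qed
  have rhs: "(\<integral>\<theta>. measure (P \<theta>) {x \<in> space \<mu>. \<Upsilon> \<theta> \<in> C x} \<partial>\<pi>) = (\<integral>x. \<beta> x \<partial>M)"
  proof -
    have "measure (P \<theta>) {x \<in> space \<mu>. \<Upsilon> \<theta> \<in> C x} = (\<integral>x. indicator (C x) (\<Upsilon> \<theta>) \<partial>P \<theta>)" for \<theta>
    proof -
      have "(\<integral>x. indicator (C x) (\<Upsilon> \<theta>) \<partial>P \<theta>) = (\<integral>x. indicator {x \<in> space \<mu>. \<Upsilon> \<theta> \<in> C x} x \<partial>P \<theta> :: real)"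
        by (intro Bochner_Integration.integral_cong) (auto simp: indicator_def P_def)
      then show ?thesis by (simp add: P_def Int_absorb2)
    qed
    then have "(\<integral>\<theta>. measure (P \<theta>) {x \<in> space \<mu>. \<Upsilon> \<theta> \<in> C x} \<partial>\<pi>)
        = (\<integral>\<theta>. \<integral>x. indicator (C x) (\<Upsilon> \<theta>) \<partial>model \<mu> f \<theta> \<partial>pri)"
      by (simp add: P_def \<pi>_def)
    \<comment> \<open>Unlike the independent value, the true value depends on the observation; given
      \<open>x\<close> it has law \<open>Q x\<close>, so the inner integral is
      \<open>\<beta> x\<close>.\<close>
    also have "\<dots> = (\<integral>x. \<integral>\<theta>. indicator (C x) (\<Upsilon> \<theta>) \<partial>post x \<partial>marg)"
    proof (rule integral_disintegration)
      show "(\<lambda>(\<theta>, x). indicator (C x) (\<Upsilon> \<theta>) :: real) \<in> borel_measurable (\<upsilon> \<Otimes>\<^sub>M \<mu>)" by measurable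
    qed (auto simp: indicator_def)
    also have "\<dots> = (\<integral>x. \<beta> x \<partial>M)"
      unfolding M_def by (intro Bochner_Integration.integral_cong) (auto simp: \<beta>_int)
    finally show ?thesis .
  qed
  interpret M: prob_space M unfolding M_def by unfold_locales
  have [measurable_cong]: "sets M = sets \<mu>" by (simp add: M_def)
  have int_\<alpha>: "integrable M \<alpha>"
    by (rule M.integrable_const_bound[of _ 1]) (auto simp: \<alpha>_def)
  have int_\<beta>: "integrable M \<beta>"
    using pointwise by (intro M.integrable_const_bound[of _ 1]) (auto simp: \<beta>_def prob_space.prob_le_1 elim: eventually_mono)
  have le: "(\<integral>x. \<alpha> x \<partial>M) \<le> (\<integral>x. \<beta> x \<partial>M)"
    using pointwise by (intro integral_mono_AE int_\<alpha> int_\<beta>) (auto elim: eventually_mono)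
  \<comment> \<open>As \<open>\<beta> - \<alpha>\<close> is nonnegative almost everywhere, equality
    of the means forces it to vanish almost everywhere, which by \<open>pointwise\<close> means that
    \<open>\<alpha>\<close> almost surely avoids the open unit interval.\<close>
  have "(\<integral>x. \<alpha> x \<partial>M) < (\<integral>x. \<beta> x \<partial>M) \<longleftrightarrow> (\<integral>x. \<beta> x - \<alpha> x \<partial>M) \<noteq> 0"
    using le int_\<alpha> int_\<beta> by auto
  also have "\<dots> \<longleftrightarrow> \<not> (AE x in M. \<beta> x - \<alpha> x = 0)"
    using pointwise int_\<alpha> int_\<beta> by (subst integral_nonneg_eq_0_iff_AE) (auto elim: eventually_mono)
  also have "(AE x in M. \<beta> x - \<alpha> x = 0) \<longleftrightarrow> (AE x in M. \<not> (0 < \<alpha> x \<and> \<alpha> x < 1))"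
  proof (rule eventually_subst)
    show "AE x in M. \<beta> x - \<alpha> x = 0 \<longleftrightarrow> \<not> (0 < \<alpha> x \<and> \<alpha> x < 1)"
      using pointwise by (rule eventually_mono) linarith
  qed
  also have "\<dots> \<longleftrightarrow> measure M {x \<in> space \<mu>. 0 < \<alpha> x \<and> \<alpha> x < 1} = 0"
  proof -
    have "{x \<in> space \<mu>. 0 < \<alpha> x \<and> \<alpha> x < 1} \<in> sets M" by measurable
    from M.prob_eq_0[OF this] show ?thesis
      using AE_space[of M] by (auto simp: M_def elim: eventually_elim2)
  qed
  finally have "(\<integral>x. \<alpha> x \<partial>M) < (\<integral>x. \<beta> x \<partial>M) \<longleftrightarrow> 0 < measure M {x \<in> space \<mu>. 0 < \<alpha> x \<and> \<alpha> x < 1}"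
    by (simp add: zero_less_measure_iff)
  with le show ?thesis
    unfolding lhs rhs \<alpha>_def[symmetric] by blast
qed

end
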